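(* Let $q\ge 3$. The following hold. (1) If $\mathbf u\in\mathbb R^2$ is such that the orbit $G_q\mathbf u=\{A\mathbf u: A\in G_q\}$ is a discrete subset of $\mathbb R^2$, then either $\mathbf u=(0,0)^T$ or there is a nonzero $\alpha\in\mathbb R$ with $G_q\mathbf u=\alpha\Lambda_q$. (2) No element $\mathbf v\in\Lambda_q$ satisfies $Q_q(\mathbf v)<1$, where $Q_q((x,y)^T)=x^2-\lambda_q xy+y^2$; i.e. the open interior of the ellipse $Q_q=1$ contains no element of $\Lambda_q$. (3) $\mathfrak w_i^q\wedge\mathfrak w_{i+1}^q=1$ for $i=0,1,\dots,q-2$, and $\mathfrak w_0^q\wedge\mathfrak w_{q-1}^q=1$. (4) If $\mathbf u_0,\mathbf u_1\in\Lambda_q$ satisfy $\mathbf u_0\wedge\mathbf u_1=1$, then there exists $A\in G_q$ with $A\mathbf u_0=(1,0)^T$ and $A\mathbf u_1=(0,1)^T$; equivalently, the matrix with columns $\mathbf u_0,\mathbf u_1$ belongs to $G_q$. Thus unimodular pairs of elements of $\Lambda_q$ are exactly the column pairs of matrices in $G_q$.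
   Context: Fix an integer $q\ge3$, let $\lambda_q=2\cos(\pi/q)$, and let $G_q\subset \mathrm{SL}(2,\mathbb R)$ be the Hecke triangle group generated by $S=\begin{pmatrix}0&-1\\1&0\end{pmatrix}$ and $T_q=\begin{pmatrix}1&\lambda_q\\0&1\end{pmatrix}$, acting linearly on $\mathbb R^2$ (column vectors). Set $\Lambda_q=G_q(1,0)^T=\{A(1,0)^T:A\in G_q\}$. Let $U_q=T_qS=\begin{pmatrix}\lambda_q&-1\\1&0\end{pmatrix}$ and $\mathfrak w_i^q=(x_i^q,y_i^q)^T=U_q^i(1,0)^T$ for $i=0,1,\dots,2q-1$ (so $\mathfrak w_0^q=(1,0)^T$, $\mathfrak w_1^q=(\lambda_q,1)^T$, $\mathfrak w_{q-1}^q=(0,1)^T$). For $\mathbf u_0=(x_0,y_0)^T,\mathbf u_1=(x_1,y_1)^T$, the wedge product is $\mathbf u_0\wedge\mathbf u_1=x_0y_1-x_1y_0$; the pair is called unimodular if $\mathbf u_0\wedge\mathbf u_1=1$. *)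

theory Defs
  imports "HOL-Analysis.Analysis"
begin

text \<open>Vectors in R^2 are real^2 (components 1 and 2); 2x2 matrices are real^2^2 (rows).\<close>

definition vec2 :: "real \<Rightarrow> real \<Rightarrow> real^2" where
  "vec2 x y = vector [x, y]"

definition mat2 :: "real \<Rightarrow> real \<Rightarrow> real \<Rightarrow> real \<Rightarrow> real^2^2" where
  "mat2 a b c d = vector [vector [a, b], vector [c, d]]"

definition hecke_lambda :: "nat \<Rightarrow> real" where
  "hecke_lambda q = 2 * cos (pi / real q)"

definition hecke_S :: "real^2^2" where
  "hecke_S = mat2 0 (-1) 1 0"

definition hecke_T :: "nat \<Rightarrow> real^2^2" where
  "hecke_T q = mat2 1 (hecke_lambda q) 0 1"

text \<open>The Hecke group G_q: the subgroup of SL(2,R) generated by S and T_q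
  (closure of the identity under left multiplication by S, T_q and their inverses).\<close>
inductive_set hecke_group :: "nat \<Rightarrow> (real^2^2) set" for q :: nat where
  id: "mat 1 \<in> hecke_group q"
| S: "A \<in> hecke_group q \<Longrightarrow> hecke_S ** A \<in> hecke_group q"
| T: "A \<in> hecke_group q \<Longrightarrow> hecke_T q ** A \<in> hecke_group q"
| S_inv: "A \<in> hecke_group q \<Longrightarrow> matrix_inv hecke_S ** A \<in> hecke_group q"
| T_inv: "A \<in> hecke_group q \<Longrightarrow> matrix_inv (hecke_T q) ** A \<in> hecke_group q"

definition orbit :: "nat \<Rightarrow> real^2 \<Rightarrow> (real^2) set" where
  "orbit q u = (\<lambda>A. A *v u) ` hecke_group q"

definition hecke_Lambda :: "nat \<Rightarrow> (real^2) set" where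
  "hecke_Lambda q = orbit q (vec2 1 0)"

definition hecke_Q :: "nat \<Rightarrow> real^2 \<Rightarrow> real" where
  "hecke_Q q v = (v$1)^2 - hecke_lambda q * (v$1) * (v$2) + (v$2)^2"

definition hecke_U :: "nat \<Rightarrow> real^2^2" where
  "hecke_U q = hecke_T q ** hecke_S"

text \<open>w_i = U_q^i (1,0)^T\<close>
definition hecke_w :: "nat \<Rightarrow> nat \<Rightarrow> real^2" where
  "hecke_w q i = (((*v) (hecke_U q)) ^^ i) (vec2 1 0)"

definition wedge :: "real^2 \<Rightarrow> real^2 \<Rightarrow> real" where
  "wedge u v = u$1 * v$2 - v$1 * u$2"

end

theory Submission
  imports Defs
begin

text \<open>
  The entries of U^k are the numbers s_k = sin(k\<pi>/q) / sin(\<pi>/q), which satisfy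
  s_(k+1) = \<lambda> s_k - s_(k-1); hence U^q = -1 and U^(q-1) (1,0) = (0,1). Since U preserves Q and
  w \<and> U w = Q(w), consecutive w_i form unimodular pairs.

  The group is generated by S, U and -1, so \<Lambda> lies in the set of all U^k t with t a seed, the
  seeds being generated from (1,0) by negation and by t \<mapsto> S U^a t for 0 < a < q. All s_k with
  0 \<le> k \<le> q are non-negative, so these U^a map the second and fourth quadrants, where
  Q \<ge> |.|^2, into the first and third, where Q \<le> |.|^2. By induction every seed satisfies
  x y \<le> 0 and |t| \<ge> 1, hence Q \<ge> 1 on \<Lambda>.

  For a unimodular pair, moving u_0 to (1,0) turns u_1 into some (b,1); a power of T achieves
  |b| \<le> \<lambda>/2, and then Q \<ge> 1 forces b = 0.

  If an orbit point lies on the horizontal axis, the orbit is a multiple of \<Lambda>. Otherwise S T^k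
  shrinks the second coordinate by the factor \<lambda>/2 < 1, so every point of the horizontal axis is
  a limit point of the orbit; transporting these by the group shows that the orbit accumulates at
  its own points.
\<close>

lemma exists_int_multiple_near:
  fixes x h :: real
  assumes "h \<noteq> 0"
  obtains k :: int where "\<bar>x - of_int k * h\<bar> \<le> \<bar>h\<bar> / 2"
proof
  have "\<bar>x - of_int (round (x / h)) * h\<bar> = \<bar>of_int (round (x / h)) - x / h\<bar> * \<bar>h\<bar>"
    using assms by (simp add: abs_mult[symmetric] left_diff_distrib abs_minus_commute)
  also have "\<dots> \<le> 1 / 2 * \<bar>h\<bar>" by (intro mult_right_mono of_int_round_abs_le) simp
  finally show "\<bar>x - of_int (round (x / h)) * h\<bar> \<le> \<bar>h\<bar> / 2" by simp
qed

lemma vec2_nth [simp]: "vec2 x y $ 1 = x" "vec2 x y $ 2 = y"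
  by (simp_all add: vec2_def)

lemma vec2_eta: "v = vec2 (v$1) (v$2)"
  by (simp add: vec_eq_iff forall_2)

lemma vec2_eq_iff: "vec2 a b = vec2 c d \<longleftrightarrow> a = c \<and> b = d"
  by (auto simp: vec_eq_iff forall_2)

lemma mat2_nth [simp]: "mat2 a b c d $ 1 = vec2 a b" "mat2 a b c d $ 2 = vec2 c d"
  by (simp_all add: mat2_def vec2_def)

lemma mat2_eta: "(A::real^2^2) = mat2 (A$1$1) (A$1$2) (A$2$1) (A$2$2)"
  by (simp add: vec_eq_iff forall_2)

lemma mat2_mulv [simp]: "mat2 a b c d *v v = vec2 (a * v$1 + b * v$2) (c * v$1 + d * v$2)"
  by (simp add: vec_eq_iff forall_2 matrix_vector_mult_def sum_2)

lemma mat2_mult [simp]: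
  "mat2 a b c d ** mat2 a' b' c' d' = mat2 (a*a' + b*c') (a*b' + b*d') (c*a' + d*c') (c*b' + d*d')"
  by (simp add: vec_eq_iff forall_2 matrix_matrix_mult_def sum_2)

lemma mat2_one: "(mat 1 :: real^2^2) = mat2 1 0 0 1"
  by (simp add: vec_eq_iff forall_2 mat_def)

lemma mat2_columns_eq:
  assumes "B *v vec2 1 0 = u" "B *v vec2 0 1 = w"
  shows "mat2 (u$1) (w$1) (u$2) (w$2) = B"
  unfolding assms[symmetric] by (simp add: vec_eq_iff forall_2 matrix_vector_mult_def sum_2)

lemma det_mat2 [simp]: "det (mat2 a b c d) = a*d - b*c"
  by (simp add: det_2)

lemma wedge_mulv: "wedge (A *v v) (A *v w) = det A * wedge v w"
  by (simp add: wedge_def det_2 matrix_vector_mult_def sum_2 algebra_simps)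

lemma matrix_vector_mult_uminus: "A *v (- x) = - (A *v x)" for A :: "real^'n^'m"
  using matrix_vector_mult_diff_distrib[of A 0 x] by simp

lemma norm_vec2: "norm (vec2 x y) = sqrt (x\<^sup>2 + y\<^sup>2)"
  by (simp add: norm_vec_def L2_set_def sum_2)

lemma norm_vec2_le: "norm (vec2 a b) \<le> \<bar>a\<bar> + \<bar>b\<bar>"
  using norm_le_l1_cart[of "vec2 a b"] by (simp add: sum_2)

lemma exists_short_vector_on_line:
  fixes a b c d y :: real
  assumes "a * d - b * c = 1" "1 \<le> 2 * (a\<^sup>2 + c\<^sup>2)"
  obtains s where "norm (mat2 a b c d *v vec2 s y) \<le> 2 * \<bar>y\<bar>"
proof
  define n where "n = a\<^sup>2 + c\<^sup>2"
  define s where "s = - y * (a * b + c * d) / n"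
  have n: "n > 0" using assms(2) by (simp add: n_def)
  \<comment> \<open>Lagrange's identity\<close>
  have "n * ((a * s + b * y)\<^sup>2 + (c * s + d * y)\<^sup>2)
      = (n * s + y * (a * b + c * d))\<^sup>2 + y\<^sup>2 * (a * d - b * c)\<^sup>2"
    unfolding n_def by algebra
  also have "\<dots> = y\<^sup>2" using n assms(1) by (simp add: s_def)
  finally have "n * ((a * s + b * y)\<^sup>2 + (c * s + d * y)\<^sup>2) = y\<^sup>2" .
  then have "(a * s + b * y)\<^sup>2 + (c * s + d * y)\<^sup>2 = y\<^sup>2 / n"
    using n by (simp add: field_simps)
  also have "\<dots> \<le> 2 * y\<^sup>2"
  proof -
    have "y\<^sup>2 * 1 \<le> y\<^sup>2 * (2 * n)" using assms(2) by (intro mult_left_mono) (simp_all add: n_def)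
    then show ?thesis using n by (simp add: divide_le_eq)
  qed
  also have "\<dots> \<le> (2 * \<bar>y\<bar>)\<^sup>2" by (simp add: power_mult_distrib)
  finally have "(a * s + b * y)\<^sup>2 + (c * s + d * y)\<^sup>2 \<le> (2 * \<bar>y\<bar>)\<^sup>2" .
  then show "norm (mat2 a b c d *v vec2 s y) \<le> 2 * \<bar>y\<bar>"
    by (simp add: norm_vec2 real_sqrt_le_iff real_le_lsqrt)
qed

lemma matrix_inv_eqI:
  fixes A B :: "real^'n^'n"
  assumes "A ** B = mat 1" "B ** A = mat 1"
  shows "matrix_inv A = B"
proof -
  have inv: "A ** matrix_inv A = mat 1 \<and> matrix_inv A ** A = mat 1"
    unfolding matrix_inv_def using assms
    by (intro someI_ex[of "\<lambda>A'. A ** A' = mat 1 \<and> A' ** A = mat 1"]) blast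
  have "matrix_inv A = matrix_inv A ** (A ** B)" using assms by simp
  also have "\<dots> = B" using inv by (simp add: matrix_mul_assoc)
  finally show ?thesis .
qed

subsection \<open>The Hecke group and its orbits\<close>

lemma hecke_lambda_bounds:
  assumes "q \<ge> 3"
  shows "1 \<le> hecke_lambda q" "hecke_lambda q < 2"
proof -
  have pos: "0 < pi / real q" using assms by simp
  have le: "pi / real q \<le> pi / 3" using assms by (intro divide_left_mono) auto
  then have "cos (pi / 3) \<le> cos (pi / real q)"
    using pos by (intro cos_monotone_0_pi_le) auto
  then show "1 \<le> hecke_lambda q" by (simp add: hecke_lambda_def cos_60)
  have "cos (pi / real q) < cos 0"
    using pos le pi_gt_zero by (intro cos_monotone_0_pi) linarith+
  then show "hecke_lambda q < 2" by (simp add: hecke_lambda_def)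
qed

lemma hecke_S_mulv [simp]: "hecke_S *v v = vec2 (- v$2) (v$1)"
  by (subst vec2_eta[of v]) (simp add: hecke_S_def)

lemma hecke_T_mulv [simp]: "hecke_T q *v v = vec2 (v$1 + hecke_lambda q * v$2) (v$2)"
  by (subst vec2_eta[of v]) (simp add: hecke_T_def)

lemma hecke_U_mulv: "hecke_U q *v v = vec2 (hecke_lambda q * v$1 - v$2) (v$1)"
  by (subst vec2_eta[of v]) (simp add: hecke_U_def hecke_T_def hecke_S_def)

lemma matrix_inv_hecke_S: "matrix_inv hecke_S = mat2 0 1 (-1) 0"
  by (rule matrix_inv_eqI) (simp_all add: hecke_S_def mat2_one)

lemma matrix_inv_hecke_T: "matrix_inv (hecke_T q) = mat2 1 (- hecke_lambda q) 0 1"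
  by (rule matrix_inv_eqI) (simp_all add: hecke_T_def mat2_one)

lemma hecke_group_mult:
  "A \<in> hecke_group q \<Longrightarrow> B \<in> hecke_group q \<Longrightarrow> A ** B \<in> hecke_group q"
  by (induction A rule: hecke_group.induct) (auto simp: matrix_mul_assoc[symmetric] intro: hecke_group.intros)

lemma hecke_generators_in_group:
  "hecke_S \<in> hecke_group q" "hecke_T q \<in> hecke_group q"
  "matrix_inv hecke_S \<in> hecke_group q" "matrix_inv (hecke_T q) \<in> hecke_group q"
  using hecke_group.intros(2-5)[OF hecke_group.id, of q] by simp_all

lemma hecke_group_left_inverse: "A \<in> hecke_group q \<Longrightarrow> \<exists>C \<in> hecke_group q. C ** A = mat 1"
proof -
  have step: "\<exists>C' \<in> hecke_group q. C' ** (X ** A) = mat 1"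
    if IH: "\<exists>C \<in> hecke_group q. C ** A = mat 1" and Y: "Y \<in> hecke_group q" "Y ** X = mat 1"
    for X Y A
  proof -
    obtain C where "C \<in> hecke_group q" "C ** A = mat 1" using IH by blast
    moreover have "(C ** Y) ** (X ** A) = C ** (Y ** X) ** A" by (simp add: matrix_mul_assoc)
    ultimately show ?thesis using Y hecke_group_mult by fastforce
  qed
  have inv: "matrix_inv hecke_S ** hecke_S = mat 1" "hecke_S ** matrix_inv hecke_S = mat 1"
    "matrix_inv (hecke_T q) ** hecke_T q = mat 1" "hecke_T q ** matrix_inv (hecke_T q) = mat 1"
    unfolding matrix_inv_hecke_S matrix_inv_hecke_T by (simp_all add: hecke_S_def hecke_T_def mat2_one)
  show "A \<in> hecke_group q \<Longrightarrow> ?thesis"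
  proof (induction A rule: hecke_group.induct)
    case id
    then show ?case using hecke_group.id by force
  qed (use step inv hecke_generators_in_group in blast)+
qed

lemma hecke_group_inverse:
  assumes "A \<in> hecke_group q"
  shows "matrix_inv A \<in> hecke_group q" "matrix_inv A ** A = mat 1" "A ** matrix_inv A = mat 1"
proof -
  obtain C where C: "C \<in> hecke_group q" "C ** A = mat 1"
    using hecke_group_left_inverse[OF assms] by blast
  then have "matrix_inv A = C"
    by (intro matrix_inv_eqI) (simp_all add: matrix_left_right_inverse)
  then show "matrix_inv A \<in> hecke_group q" "matrix_inv A ** A = mat 1" "A ** matrix_inv A = mat 1"
    using C by (simp_all add: matrix_left_right_inverse)
qed

lemma det_hecke_group: "A \<in> hecke_group q \<Longrightarrow> det A = 1"
proof -
  have gens: "det hecke_S = 1" "det (hecke_T q) = 1"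
    "det (matrix_inv hecke_S) = 1" "det (matrix_inv (hecke_T q)) = 1"
    by (simp_all only: matrix_inv_hecke_S matrix_inv_hecke_T) (simp_all add: hecke_S_def hecke_T_def)
  show "A \<in> hecke_group q \<Longrightarrow> det A = 1"
    by (induction A rule: hecke_group.induct) (simp_all add: det_mul gens)
qed

lemma hecke_T_power_in_group: "mat2 1 (of_int k * hecke_lambda q) 0 1 \<in> hecke_group q"
proof -
  have pos: "mat2 1 (real n * hecke_lambda q) 0 1 \<in> hecke_group q" for n
  proof (induction n)
    case 0
    then show ?case using hecke_group.id[of q] by (simp add: mat2_one)
  next
    case (Suc n)
    then show ?case using hecke_group.T[OF Suc]
      by (simp add: hecke_T_def algebra_simps)
  qed
  have neg: "mat2 1 (- real n * hecke_lambda q) 0 1 \<in> hecke_group q" for n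
  proof (induction n)
    case 0
    then show ?case using hecke_group.id[of q] by (simp add: mat2_one)
  next
    case (Suc n)
    then show ?case using hecke_group.T_inv[OF Suc]
      by (simp add: matrix_inv_hecke_T algebra_simps)
  qed
  show ?thesis
    using pos[of "nat k"] neg[of "nat (- k)"] by (cases "k \<ge> 0") simp_all
qed

lemma orbit_mulv: "v \<in> orbit q u \<Longrightarrow> A \<in> hecke_group q \<Longrightarrow> A *v v \<in> orbit q u"
  unfolding orbit_def by (auto simp: matrix_vector_mul_assoc intro: hecke_group_mult)

lemma self_in_orbit: "u \<in> orbit q u"
  unfolding orbit_def using hecke_group.id by force

lemma orbit_of_mulv: "A \<in> hecke_group q \<Longrightarrow> orbit q (A *v u) = orbit q u"
proof
  assume A: "A \<in> hecke_group q"
  show "orbit q (A *v u) \<subseteq> orbit q u"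
    unfolding orbit_def by (auto simp: matrix_vector_mul_assoc intro: hecke_group_mult A)
  have "u = matrix_inv A *v (A *v u)"
    using hecke_group_inverse(2)[OF A] by (simp add: matrix_vector_mul_assoc)
  then show "orbit q u \<subseteq> orbit q (A *v u)"
    by (metis A orbit_def hecke_group_inverse(1) image_subsetI orbit_mulv self_in_orbit)
qed

lemma orbit_scaleR: "orbit q (c *\<^sub>R u) = (\<lambda>v. c *\<^sub>R v) ` orbit q u"
  unfolding orbit_def by (auto simp: matrix_vector_mult_scaleR image_image)

subsection \<open>Powers of \<open>U\<close>\<close>

definition hecke_cheb :: "nat \<Rightarrow> int \<Rightarrow> real" where
  "hecke_cheb q k = sin (of_int k * pi / real q) / sin (pi / real q)"

lemma sin_pi_div_pos: "q \<ge> 3 \<Longrightarrow> sin (pi / real q) > 0"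
  by (intro sin_gt_zero) (auto simp: field_simps)

lemma hecke_cheb_rec:
  assumes "q \<ge> 3"
  shows "hecke_cheb q (k + 1) = hecke_lambda q * hecke_cheb q k - hecke_cheb q (k - 1)"
proof -
  define t where "t = pi / real q"
  define a where "a = of_int k * t"
  have "of_int (k + 1) * pi / real q = a + t" "of_int (k - 1) * pi / real q = a - t"
    "of_int k * pi / real q = a"
    by (simp_all add: a_def t_def algebra_simps add_divide_distrib diff_divide_distrib)
  moreover have "sin (a + t) = 2 * cos t * sin a - sin (a - t)"
    by (simp add: sin_add sin_diff)
  ultimately show ?thesis
    unfolding hecke_cheb_def hecke_lambda_def t_def[symmetric] by (simp add: diff_divide_distrib)
qed

lemma hecke_cheb_values:
  assumes "q \<ge> 3"
  shows "hecke_cheb q 0 = 0" "hecke_cheb q 1 = 1" "hecke_cheb q (-1) = -1"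
    "hecke_cheb q (int q - 1) = 1" "hecke_cheb q (int q) = 0" "hecke_cheb q (int q + 1) = -1"
proof -
  have "of_int (int q - 1) * pi / real q = pi - pi / real q"
    "of_int (int q + 1) * pi / real q = pi + pi / real q"
    using assms by (simp_all add: field_simps)
  then show "hecke_cheb q 0 = 0" "hecke_cheb q 1 = 1" "hecke_cheb q (-1) = -1"
    "hecke_cheb q (int q - 1) = 1" "hecke_cheb q (int q) = 0" "hecke_cheb q (int q + 1) = -1"
    using sin_pi_div_pos[OF assms] assms by (simp_all add: hecke_cheb_def sin_add)
qed

lemma hecke_cheb_nonneg:
  assumes "q \<ge> 3" "0 \<le> k" "k \<le> int q"
  shows "hecke_cheb q k \<ge> 0"
proof -
  have "0 \<le> of_int k * pi / real q" "of_int k * pi / real q \<le> pi"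
    using assms by (simp_all add: field_simps mult_right_mono)
  then have "sin (of_int k * pi / real q) \<ge> 0" by (rule sin_ge_zero)
  then show ?thesis using sin_pi_div_pos[OF assms(1)] by (simp add: hecke_cheb_def)
qed

lemma hecke_U_power:
  assumes "q \<ge> 3"
  shows "((*v) (hecke_U q) ^^ k) v =
    vec2 (hecke_cheb q (int k + 1) * v$1 - hecke_cheb q (int k) * v$2)
         (hecke_cheb q (int k) * v$1 - hecke_cheb q (int k - 1) * v$2)"
proof (induction k)
  case 0
  show ?case using hecke_cheb_values[OF assms] by (simp add: vec_eq_iff forall_2)
next
  case (Suc k)
  have rec: "hecke_cheb q (int k + 1 + 1) = hecke_lambda q * hecke_cheb q (int k + 1) - hecke_cheb q (int k)"
    "hecke_cheb q (int k + 1) = hecke_lambda q * hecke_cheb q (int k) - hecke_cheb q (int k - 1)"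
    using hecke_cheb_rec[OF assms, of "int k + 1"] hecke_cheb_rec[OF assms, of "int k"]
    by (simp_all only: add_diff_cancel_right')
  have three_term: "l * (b * x - a * y) - (a * x - d * y) = c * x - b * y"
    if "c = l * b - a" "b = l * a - d" for l a b c d x y :: real
    using that by algebra
  have "int (Suc k) = int k + 1" by simp
  then show ?case
    unfolding funpow.simps comp_apply Suc.IH unfolding hecke_U_mulv vec2_nth
    by (simp only: add_diff_cancel_right' three_term[OF rec])
qed

lemma hecke_U_power_q: "q \<ge> 3 \<Longrightarrow> ((*v) (hecke_U q) ^^ q) v = - v"
  by (simp add: hecke_U_power hecke_cheb_values vec_eq_iff forall_2 add.commute[of 1])

lemma hecke_U_power_pred_q:
  assumes "q \<ge> 3"
  shows "((*v) (hecke_U q) ^^ (q - 1)) v = vec2 (- v$2) (v$1 - hecke_lambda q * v$2)"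
proof -
  define w where "w = vec2 (v$2) (hecke_lambda q * v$2 - v$1)"
  have "hecke_U q *v w = v" by (simp add: hecke_U_mulv w_def vec2_eta[symmetric])
  then have "((*v) (hecke_U q) ^^ (q - 1)) v = ((*v) (hecke_U q) ^^ Suc (q - 1)) w"
    by (simp only: funpow_Suc_right comp_apply)
  also have "\<dots> = ((*v) (hecke_U q) ^^ q) w" using assms by simp
  also have "\<dots> = - w" by (rule hecke_U_power_q[OF assms])
  finally show ?thesis by (simp add: w_def vec_eq_iff forall_2)
qed

lemma hecke_U_power_uminus: "((*v) (hecke_U q) ^^ k) (- v) = - ((*v) (hecke_U q) ^^ k) v"
  by (induction k) (simp_all add: matrix_vector_mult_uminus)

lemma hecke_Q_hecke_U [simp]: "hecke_Q q (hecke_U q *v v) = hecke_Q q v"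
  by (simp add: hecke_U_mulv hecke_Q_def power2_eq_square algebra_simps)

lemma hecke_Q_hecke_U_power [simp]: "hecke_Q q (((*v) (hecke_U q) ^^ k) v) = hecke_Q q v"
  by (induction k) simp_all

lemma wedge_hecke_U: "wedge v (hecke_U q *v v) = hecke_Q q v"
  by (simp add: hecke_U_mulv hecke_Q_def wedge_def power2_eq_square algebra_simps)

lemma wedge_hecke_w_Suc: "wedge (hecke_w q i) (hecke_w q (Suc i)) = 1"
  by (simp add: hecke_w_def wedge_hecke_U) (simp add: hecke_Q_def)

lemma hecke_w_pred_q: "q \<ge> 3 \<Longrightarrow> hecke_w q (q - 1) = vec2 0 1"
  using hecke_U_power_pred_q[of q "vec2 1 0"] by (simp add: hecke_w_def)

subsection \<open>The quadratic form on \<open>\<Lambda>\<^sub>q\<close>\<close>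

lemma hecke_Q_ge_norm_sq:
  assumes "q \<ge> 3" "v$1 * v$2 \<le> 0"
  shows "(v$1)\<^sup>2 + (v$2)\<^sup>2 \<le> hecke_Q q v"
  using assms hecke_lambda_bounds[OF assms(1)]
  by (simp add: hecke_Q_def mult_nonneg_nonpos mult.assoc)

lemma hecke_Q_le_norm_sq:
  assumes "q \<ge> 3" "v$1 * v$2 \<ge> 0"
  shows "hecke_Q q v \<le> (v$1)\<^sup>2 + (v$2)\<^sup>2"
  using assms hecke_lambda_bounds[OF assms(1)]
  by (simp add: hecke_Q_def mult.assoc)

lemma hecke_Q_le_two_norm_sq:
  assumes "q \<ge> 3"
  shows "hecke_Q q v \<le> 2 * ((v$1)\<^sup>2 + (v$2)\<^sup>2)"
proof -
  have "- (hecke_lambda q * (v$1 * v$2)) \<le> hecke_lambda q * \<bar>v$1 * v$2\<bar>"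
    using hecke_lambda_bounds[OF assms] mult_left_mono[of "- (v$1 * v$2)" "\<bar>v$1 * v$2\<bar>"]
    by simp
  also have "\<dots> \<le> 2 * \<bar>v$1 * v$2\<bar>"
    using hecke_lambda_bounds[OF assms] by (intro mult_right_mono) auto
  also have "\<dots> \<le> (v$1)\<^sup>2 + (v$2)\<^sup>2"
    using sum_squares_bound[of "\<bar>v$1\<bar>" "\<bar>v$2\<bar>"] by (simp add: abs_mult power2_eq_square)
  finally show ?thesis by (simp add: hecke_Q_def mult.assoc)
qed

lemma hecke_U_power_sign:
  assumes "q \<ge> 3" "1 \<le> a" "a \<le> q - 1" "t$1 * t$2 \<le> 0"
  defines "z \<equiv> ((*v) (hecke_U q) ^^ a) t"
  shows "z$1 * z$2 \<ge> 0"
proof -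
  let ?c = "hecke_cheb q"
  have c: "?c (int a + 1) \<ge> 0" "?c (int a) \<ge> 0" "?c (int a - 1) \<ge> 0"
    using assms by (auto intro!: hecke_cheb_nonneg)
  have z: "z$1 = ?c (int a + 1) * t$1 - ?c (int a) * t$2" "z$2 = ?c (int a) * t$1 - ?c (int a - 1) * t$2"
    unfolding z_def hecke_U_power[OF assms(1)] by simp_all
  consider "t$1 \<le> 0" "0 \<le> t$2" | "0 \<le> t$1" "t$2 \<le> 0"
    using assms(4) by (auto simp: mult_le_0_iff)
  then show ?thesis
  proof cases
    case 1
    then have "z$1 \<le> 0" "z$2 \<le> 0"
      unfolding z using c by (auto intro: order_trans[OF mult_nonneg_nonpos mult_nonneg_nonneg])
    then show ?thesis by (simp add: mult_nonpos_nonpos)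
  next
    case 2
    then have "z$1 \<ge> 0" "z$2 \<ge> 0"
      unfolding z using c by (auto intro: order_trans[OF mult_nonneg_nonpos mult_nonneg_nonneg])
    then show ?thesis by simp
  qed
qed

inductive_set hecke_seeds :: "nat \<Rightarrow> (real^2) set" for q :: nat where
  base: "vec2 1 0 \<in> hecke_seeds q"
| neg: "t \<in> hecke_seeds q \<Longrightarrow> - t \<in> hecke_seeds q"
| step: "t \<in> hecke_seeds q \<Longrightarrow> 1 \<le> a \<Longrightarrow> a \<le> q - 1 \<Longrightarrow>
    hecke_S *v ((*v) (hecke_U q) ^^ a) t \<in> hecke_seeds q"

lemma hecke_seeds_bounds:
  assumes "q \<ge> 3" "t \<in> hecke_seeds q"
  shows "t$1 * t$2 \<le> 0 \<and> 1 \<le> (t$1)\<^sup>2 + (t$2)\<^sup>2"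
  using assms(2)
proof (induction t rule: hecke_seeds.induct)
  case (step t a)
  define z where "z = ((*v) (hecke_U q) ^^ a) t"
  have "z$1 * z$2 \<ge> 0"
    unfolding z_def using hecke_U_power_sign[OF assms(1) step.hyps(2,3)] step.IH by blast
  moreover have "1 \<le> (z$1)\<^sup>2 + (z$2)\<^sup>2"
  proof -
    have "1 \<le> hecke_Q q t" using step.IH hecke_Q_ge_norm_sq[OF assms(1)] by fastforce
    also have "\<dots> = hecke_Q q z" by (simp add: z_def)
    also have "\<dots> \<le> (z$1)\<^sup>2 + (z$2)\<^sup>2"
      using \<open>z$1 * z$2 \<ge> 0\<close> by (rule hecke_Q_le_norm_sq[OF assms(1)])
    finally show ?thesis .
  qed
  ultimately show ?case by (simp add: z_def[symmetric] mult.commute add.commute)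
qed simp_all

definition hecke_seed_orbit :: "nat \<Rightarrow> (real^2) set" where
  "hecke_seed_orbit q = {((*v) (hecke_U q) ^^ k) t | k t. t \<in> hecke_seeds q}"

lemma hecke_seeds_subset_orbit: "t \<in> hecke_seeds q \<Longrightarrow> t \<in> hecke_seed_orbit q"
  unfolding hecke_seed_orbit_def by (metis (mono_tags, lifting) funpow_0 mem_Collect_eq)

lemma hecke_seed_orbit_U_power:
  "v \<in> hecke_seed_orbit q \<Longrightarrow> ((*v) (hecke_U q) ^^ k) v \<in> hecke_seed_orbit q"
  unfolding hecke_seed_orbit_def by (auto, metis comp_apply funpow_add)

lemma hecke_seed_orbit_uminus: "v \<in> hecke_seed_orbit q \<Longrightarrow> - v \<in> hecke_seed_orbit q"
  unfolding hecke_seed_orbit_def by (auto, metis hecke_U_power_uminus hecke_seeds.neg)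

lemma hecke_seeds_U_power_mult_q:
  assumes "q \<ge> 3" "t \<in> hecke_seeds q"
  shows "((*v) (hecke_U q) ^^ (q * j)) t \<in> hecke_seeds q"
proof (induction j)
  case (Suc j)
  have "((*v) (hecke_U q) ^^ (q * Suc j)) t = - ((*v) (hecke_U q) ^^ (q * j)) t"
    by (simp add: funpow_add hecke_U_power_q[OF assms(1)])
  then show ?case using hecke_seeds.neg[OF Suc] by simp
qed (simp add: assms(2))

lemma hecke_seeds_S:
  assumes "q \<ge> 3" "t \<in> hecke_seeds q"
  shows "hecke_S *v t \<in> hecke_seed_orbit q"
  using assms(2)
proof (induction t rule: hecke_seeds.induct)
  case base
  have "hecke_S *v vec2 1 0 = ((*v) (hecke_U q) ^^ (q - 1)) (vec2 1 0)"
    using hecke_U_power_pred_q[OF assms(1)] by simp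
  then show ?case
    using hecke_seed_orbit_U_power hecke_seeds_subset_orbit hecke_seeds.base by metis
next
  case (neg t)
  then show ?case
    using hecke_seed_orbit_uminus by (fastforce simp: matrix_vector_mult_uminus)
next
  case (step t a)
  have "hecke_S *v (hecke_S *v v) = - v" for v by (simp add: vec_eq_iff forall_2)
  then show ?case
    using hecke_seed_orbit_uminus hecke_seed_orbit_U_power hecke_seeds_subset_orbit step.hyps(1)
    by metis
qed

lemma hecke_seed_orbit_S:
  assumes "q \<ge> 3" "v \<in> hecke_seed_orbit q"
  shows "hecke_S *v v \<in> hecke_seed_orbit q"
proof -
  obtain k t where v: "v = ((*v) (hecke_U q) ^^ k) t" and t: "t \<in> hecke_seeds q"
    using assms(2) unfolding hecke_seed_orbit_def by blast
  define t' where "t' = ((*v) (hecke_U q) ^^ (q * (k div q))) t"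
  have t': "t' \<in> hecke_seeds q"
    unfolding t'_def by (rule hecke_seeds_U_power_mult_q[OF assms(1) t])
  have v': "v = ((*v) (hecke_U q) ^^ (k mod q)) t'"
    unfolding v t'_def by (metis comp_apply funpow_add mod_mult_div_eq)
  show ?thesis
  proof (cases "k mod q = 0")
    case True
    then show ?thesis using v' hecke_seeds_S[OF assms(1) t'] by simp
  next
    case False
    moreover have "k mod q < q" using assms(1) by simp
    ultimately have "hecke_S *v v \<in> hecke_seeds q"
      unfolding v' by (intro hecke_seeds.step[OF t']) auto
    then show ?thesis by (rule hecke_seeds_subset_orbit)
  qed
qed

lemma hecke_Lambda_subset_seed_orbit:
  assumes "q \<ge> 3"
  shows "hecke_Lambda q \<subseteq> hecke_seed_orbit q"
proof -
  have "A *v vec2 1 0 \<in> hecke_seed_orbit q" if "A \<in> hecke_group q" for A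
    using that
  proof (induction A rule: hecke_group.induct)
    case id
    then show ?case using hecke_seeds_subset_orbit[OF hecke_seeds.base] by simp
  next
    case (S A)
    then show ?case
      using hecke_seed_orbit_S[OF assms S.IH] by (simp add: matrix_vector_mul_assoc[symmetric])
  next
    case (S_inv A)
    have "matrix_inv hecke_S *v v = - (hecke_S *v v)" for v
      by (simp add: matrix_inv_hecke_S vec_eq_iff forall_2)
    then show ?case
      using hecke_seed_orbit_S[OF assms S_inv.IH] hecke_seed_orbit_uminus
      by (simp add: matrix_vector_mul_assoc[symmetric])
  next
    case (T A)
    have "hecke_T q *v v = hecke_U q *v (- (hecke_S *v v))" for v
      by (simp add: hecke_U_mulv vec_eq_iff forall_2)
    then show ?case
      using hecke_seed_orbit_U_power[of _ q 1] hecke_seed_orbit_uminus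
        hecke_seed_orbit_S[OF assms T.IH]
      by (simp add: matrix_vector_mul_assoc[symmetric])
  next
    case (T_inv A)
    have "matrix_inv (hecke_T q) *v v = - (hecke_S *v ((*v) (hecke_U q) ^^ (q - 1)) v)" for v
      using hecke_U_power_pred_q[OF assms, of v] by (simp add: matrix_inv_hecke_T vec_eq_iff forall_2)
    then show ?case
      using hecke_seed_orbit_U_power hecke_seed_orbit_uminus hecke_seed_orbit_S[OF assms]
        T_inv.IH
      by (simp add: matrix_vector_mul_assoc[symmetric])
  qed
  then show ?thesis unfolding hecke_Lambda_def orbit_def by blast
qed

lemma hecke_Q_Lambda_ge_1:
  assumes "q \<ge> 3" "v \<in> hecke_Lambda q"
  shows "1 \<le> hecke_Q q v"
proof -
  obtain k t where v: "v = ((*v) (hecke_U q) ^^ k) t" and t: "t \<in> hecke_seeds q"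
    using hecke_Lambda_subset_seed_orbit[OF assms(1)] assms(2) unfolding hecke_seed_orbit_def by blast
  show ?thesis
    using hecke_seeds_bounds[OF assms(1) t] hecke_Q_ge_norm_sq[OF assms(1), of t] v by simp
qed

lemma hecke_group_first_column_bound:
  assumes "q \<ge> 3" "A \<in> hecke_group q"
  shows "1 \<le> 2 * ((A$1$1)\<^sup>2 + (A$2$1)\<^sup>2)"
proof -
  have "A *v vec2 1 0 \<in> hecke_Lambda q"
    unfolding hecke_Lambda_def using self_in_orbit assms(2) by (rule orbit_mulv)
  then have "1 \<le> hecke_Q q (A *v vec2 1 0)" by (rule hecke_Q_Lambda_ge_1[OF assms(1)])
  also have "\<dots> \<le> 2 * ((A$1$1)\<^sup>2 + (A$2$1)\<^sup>2)"
    using hecke_Q_le_two_norm_sq[OF assms(1), of "A *v vec2 1 0"]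
    by (simp add: matrix_vector_mult_def sum_2)
  finally show ?thesis .
qed

subsection \<open>Unimodular pairs\<close>

lemma hecke_Lambda_vec2_x_1_eq_0:
  assumes "q \<ge> 3" "vec2 x 1 \<in> hecke_Lambda q" "\<bar>x\<bar> \<le> hecke_lambda q / 2"
  shows "x = 0"
proof -
  have "hecke_S *v vec2 x 1 \<in> hecke_Lambda q"
    using assms(2) hecke_generators_in_group(1) unfolding hecke_Lambda_def by (rule orbit_mulv)
  then have "1 \<le> hecke_Q q (vec2 x 1)" "1 \<le> hecke_Q q (vec2 (-1) x)"
    using hecke_Q_Lambda_ge_1[OF assms(1)] assms(2) by auto
  then have nonneg: "0 \<le> x * (x - hecke_lambda q)" "0 \<le> x * (x + hecke_lambda q)"
    by (simp_all add: hecke_Q_def power2_eq_square algebra_simps)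
  have "x - hecke_lambda q < 0" "0 < x + hecke_lambda q"
    using assms(3) hecke_lambda_bounds[OF assms(1)] by linarith+
  then show ?thesis
    using nonneg mult_pos_neg[of x "x - hecke_lambda q"] mult_neg_pos[of x "x + hecke_lambda q"]
    by (cases x "0::real" rule: linorder_cases) auto
qed

lemma hecke_Lambda_unimodular_pair_in_group:
  assumes "q \<ge> 3" "u0 \<in> hecke_Lambda q" "u1 \<in> hecke_Lambda q" "wedge u0 u1 = 1"
  shows "mat2 (u0$1) (u1$1) (u0$2) (u1$2) \<in> hecke_group q"
proof -
  let ?l = "hecke_lambda q"
  obtain A where A: "A \<in> hecke_group q" "u0 = A *v vec2 1 0"
    using assms(2) unfolding hecke_Lambda_def orbit_def by blast
  define r where "r = matrix_inv A *v u1"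
  have r_Lambda: "r \<in> hecke_Lambda q"
    unfolding r_def using assms(3) hecke_group_inverse(1)[OF A(1)] unfolding hecke_Lambda_def
    by (rule orbit_mulv)
  have u0: "matrix_inv A *v u0 = vec2 1 0" and u1: "A *v r = u1"
    using hecke_group_inverse(2,3)[OF A(1)] by (simp_all add: A(2) r_def matrix_vector_mul_assoc)
  have "wedge (vec2 1 0) r = 1"
    using wedge_mulv[of "matrix_inv A" u0 u1] assms(4) det_hecke_group[OF hecke_group_inverse(1)[OF A(1)]]
    by (simp add: u0 r_def)
  then have "r$2 = 1" by (simp add: wedge_def)
  then have r: "r = vec2 (r$1) 1" by (simp add: vec_eq_iff forall_2)
  obtain k :: int where k: "\<bar>r$1 - of_int k * ?l\<bar> \<le> \<bar>?l\<bar> / 2"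
    using exists_int_multiple_near hecke_lambda_bounds[OF assms(1)] by (metis not_one_le_zero)
  have "mat2 1 (of_int (- k) * ?l) 0 1 *v r \<in> hecke_Lambda q"
    using r_Lambda hecke_T_power_in_group unfolding hecke_Lambda_def by (rule orbit_mulv)
  then have "vec2 (r$1 - of_int k * ?l) 1 \<in> hecke_Lambda q"
    by (subst (asm) r) simp
  then have "r$1 - of_int k * ?l = 0"
    using k hecke_lambda_bounds[OF assms(1)] by (intro hecke_Lambda_vec2_x_1_eq_0[OF assms(1)]) auto
  then have "r = vec2 (of_int k * ?l) 1" by (subst r) simp
  then have "mat2 (u0$1) (u1$1) (u0$2) (u1$2) = A ** mat2 1 (of_int k * ?l) 0 1"
    using A(2) u1 by (intro mat2_columns_eq) (simp_all add: matrix_vector_mul_assoc[symmetric])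
  then show ?thesis using hecke_group_mult[OF A(1) hecke_T_power_in_group] by simp
qed

lemma hecke_Lambda_unimodular_pair_normalize:
  assumes "q \<ge> 3" "u0 \<in> hecke_Lambda q" "u1 \<in> hecke_Lambda q" "wedge u0 u1 = 1"
  shows "\<exists>A \<in> hecke_group q. A *v u0 = vec2 1 0 \<and> A *v u1 = vec2 0 1"
proof
  let ?M = "mat2 (u0$1) (u1$1) (u0$2) (u1$2)"
  have M: "?M \<in> hecke_group q" by (rule hecke_Lambda_unimodular_pair_in_group[OF assms])
  show "matrix_inv ?M \<in> hecke_group q" by (rule hecke_group_inverse(1)[OF M])
  have inv: "matrix_inv ?M *v y = x" if "?M *v x = y" for x y
    using hecke_group_inverse(2)[OF M] that by (metis matrix_vector_mul_assoc matrix_vector_mul_lid)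
  show "matrix_inv ?M *v u0 = vec2 1 0 \<and> matrix_inv ?M *v u1 = vec2 0 1"
    by (intro conjI inv) (simp_all add: vec_eq_iff forall_2)
qed

subsection \<open>Discrete orbits\<close>

lemma orbit_eq_scaled_Lambda:
  assumes "v \<in> orbit q u" "v$2 = 0" "u \<noteq> 0"
  shows "\<exists>\<alpha>. \<alpha> \<noteq> 0 \<and> orbit q u = (\<lambda>w. \<alpha> *\<^sub>R w) ` hecke_Lambda q"
proof -
  obtain A where A: "A \<in> hecke_group q" "v = A *v u" using assms(1) unfolding orbit_def by blast
  have v: "v = v$1 *\<^sub>R vec2 1 0"
    using assms(2) by (simp add: vec_eq_iff forall_2)
  have "u = matrix_inv A *v v"
    using hecke_group_inverse(2)[OF A(1)] by (simp add: A(2) matrix_vector_mul_assoc)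
  then have "v$1 \<noteq> 0" using assms(3) v by (metis matrix_vector_mult_0_right scale_zero_left)
  moreover have "orbit q u = (\<lambda>w. v$1 *\<^sub>R w) ` hecke_Lambda q"
    using orbit_of_mulv[OF A(1), of u] v unfolding A(2)[symmetric]
    by (metis orbit_scaleR hecke_Lambda_def)
  ultimately show ?thesis by blast
qed

lemma orbit_second_coordinate_descent:
  assumes "q \<ge> 3" "\<forall>v \<in> orbit q u. v$2 \<noteq> 0"
  shows "\<exists>v \<in> orbit q u. \<bar>v$2\<bar> \<le> (hecke_lambda q / 2) ^ n * \<bar>u$2\<bar>"
proof (induction n)
  case 0
  then show ?case using self_in_orbit by fastforce
next
  case (Suc n)
  let ?l = "hecke_lambda q"
  obtain v where v: "v \<in> orbit q u" "\<bar>v$2\<bar> \<le> (?l / 2) ^ n * \<bar>u$2\<bar>"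
    using Suc by blast
  have "?l * v$2 \<noteq> 0" using assms(2) v(1) hecke_lambda_bounds[OF assms(1)] by simp
  then obtain k :: int where k: "\<bar>v$1 - of_int k * (?l * v$2)\<bar> \<le> \<bar>?l * v$2\<bar> / 2"
    by (rule exists_int_multiple_near)
  define w where "w = hecke_S *v (mat2 1 (of_int (- k) * ?l) 0 1 *v v)"
  have "w \<in> orbit q u"
    unfolding w_def using v(1) by (intro orbit_mulv hecke_T_power_in_group hecke_generators_in_group)
  moreover have "\<bar>w$2\<bar> \<le> ?l / 2 * \<bar>v$2\<bar>"
    using k hecke_lambda_bounds[OF assms(1)]
    by (simp add: w_def abs_mult abs_minus_commute algebra_simps)
  moreover have "?l / 2 * \<bar>v$2\<bar> \<le> (?l / 2) ^ Suc n * \<bar>u$2\<bar>"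
    using v(2) hecke_lambda_bounds[OF assms(1)] by (simp add: mult.assoc mult_left_mono)
  ultimately show ?case by force
qed

lemma orbit_second_coordinate_small:
  assumes "q \<ge> 3" "\<forall>v \<in> orbit q u. v$2 \<noteq> 0" "e > 0"
  shows "\<exists>v \<in> orbit q u. \<bar>v$2\<bar> < e"
proof -
  have l: "0 < hecke_lambda q / 2" "hecke_lambda q / 2 < 1"
    using hecke_lambda_bounds[OF assms(1)] by auto
  have "\<exists>n. (hecke_lambda q / 2) ^ n < e / (\<bar>u$2\<bar> + 1)"
    using l assms(3) by (intro real_arch_pow_inv) auto
  then obtain n where n: "(hecke_lambda q / 2) ^ n < e / (\<bar>u$2\<bar> + 1)" ..
  obtain v where v: "v \<in> orbit q u" "\<bar>v$2\<bar> \<le> (hecke_lambda q / 2) ^ n * \<bar>u$2\<bar>"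
    using orbit_second_coordinate_descent[OF assms(1,2)] by blast
  have "(hecke_lambda q / 2) ^ n * \<bar>u$2\<bar> \<le> (hecke_lambda q / 2) ^ n * (\<bar>u$2\<bar> + 1)"
    using l by (intro mult_left_mono) auto
  also have "\<dots> < e" using n by (simp add: pos_less_divide_eq)
  finally show ?thesis using v by force
qed

lemma orbit_limpt_horizontal_axis:
  assumes "q \<ge> 3" "\<forall>v \<in> orbit q u. v$2 \<noteq> 0"
  shows "vec2 x 0 islimpt orbit q u"
  unfolding islimpt_approachable
proof (intro allI impI)
  fix e :: real assume "e > 0"
  let ?l = "hecke_lambda q"
  obtain v where v: "v \<in> orbit q u" "\<bar>v$2\<bar> < e / 2"
    using orbit_second_coordinate_small[OF assms] \<open>e > 0\<close> by (meson half_gt_zero)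
  have "?l * v$2 \<noteq> 0" using assms(2) v(1) hecke_lambda_bounds[OF assms(1)] by simp
  then obtain k :: int where k: "\<bar>x - v$1 - of_int k * (?l * v$2)\<bar> \<le> \<bar>?l * v$2\<bar> / 2"
    by (rule exists_int_multiple_near)
  define w where "w = mat2 1 (of_int k * ?l) 0 1 *v v"
  have "w \<in> orbit q u" unfolding w_def using v(1) by (intro orbit_mulv hecke_T_power_in_group)
  moreover have "w \<noteq> vec2 x 0" using assms(2) v(1) by (auto simp: w_def vec2_eq_iff)
  moreover have "dist w (vec2 x 0) < e"
  proof -
    have "?l * \<bar>v$2\<bar> \<le> 2 * \<bar>v$2\<bar>"
      using hecke_lambda_bounds[OF assms(1)] by (intro mult_right_mono) auto
    then have "\<bar>w$1 - x\<bar> \<le> \<bar>v$2\<bar>"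
      using k hecke_lambda_bounds[OF assms(1)]
      by (simp add: w_def abs_mult abs_minus_commute algebra_simps)
    then have "norm (vec2 (w$1 - x) (v$2)) < e"
      using norm_vec2_le[of "w$1 - x" "v$2"] v(2) by linarith
    moreover have "w - vec2 x 0 = vec2 (w$1 - x) (v$2)"
      by (simp add: w_def vec_eq_iff forall_2)
    ultimately show ?thesis by (simp add: dist_norm)
  qed
  ultimately show "\<exists>w \<in> orbit q u. w \<noteq> vec2 x 0 \<and> dist w (vec2 x 0) < e" by blast
qed

lemma orbit_limpt_mulv:
  assumes "A \<in> hecke_group q" "w islimpt orbit q u"
  shows "A *v w islimpt orbit q u"
  unfolding islimpt_approachable
proof (intro allI impI)
  fix e :: real assume "e > 0"
  obtain K where K: "K > 0" "\<And>v. norm (A *v v) \<le> norm v * K"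
    using bounded_linear.pos_bounded[OF matrix_vector_mul_bounded_linear[of A]] by blast
  obtain v where v: "v \<in> orbit q u" "v \<noteq> w" "dist v w < e / K"
    using assms(2) \<open>e > 0\<close> K(1) unfolding islimpt_approachable by (meson divide_pos_pos)
  have "A *v v \<noteq> A *v w"
    using v(2) hecke_group_inverse(2)[OF assms(1)] by (metis matrix_vector_mul_assoc matrix_vector_mul_lid)
  moreover have "dist (A *v v) (A *v w) < e"
  proof -
    have "dist (A *v v) (A *v w) \<le> dist v w * K"
      using K(2)[of "v - w"] by (simp add: dist_norm matrix_vector_mult_diff_distrib)
    also have "\<dots> < e" using v(3) K(1) by (simp add: pos_less_divide_eq)
    finally show ?thesis .
  qed
  ultimately show "\<exists>z \<in> orbit q u. z \<noteq> A *v w \<and> dist z (A *v w) < e"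
    using orbit_mulv[OF v(1) assms(1)] by blast
qed

lemma orbit_not_discrete:
  assumes "q \<ge> 3" "\<forall>v \<in> orbit q u. v$2 \<noteq> 0"
  shows "\<not> discrete (orbit q u)"
proof
  assume "discrete (orbit q u)"
  then have "\<not> u islimpt orbit q u"
    using self_in_orbit by (meson discreteD isolated_in_islimpt_iff)
  txt \<open>Write u = C v with C in the group and v close to the horizontal axis. The image under C
    of that axis consists of limit points and passes within 2 |v_2| of u, because the first
    column of C is not short.\<close>
  moreover have "u \<in> {w. w islimpt orbit q u}"
    unfolding closed_approachable[OF closed_limpts, symmetric]
  proof (intro allI impI)
    fix e :: real assume "e > 0"
    obtain v where v: "v \<in> orbit q u" "\<bar>v$2\<bar> < e / 2"
      using orbit_second_coordinate_small[OF assms] \<open>e > 0\<close> by (meson half_gt_zero)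
    then obtain A where A: "A \<in> hecke_group q" "v = A *v u" unfolding orbit_def by blast
    define C where "C = matrix_inv A"
    have C: "C \<in> hecke_group q" "u = C *v v"
      using hecke_group_inverse[OF A(1)] by (simp_all add: C_def A(2) matrix_vector_mul_assoc)
    have "C$1$1 * C$2$2 - C$1$2 * C$2$1 = 1"
      using det_hecke_group[OF C(1)] by (simp add: det_2)
    moreover have "1 \<le> 2 * ((C$1$1)\<^sup>2 + (C$2$1)\<^sup>2)"
      by (rule hecke_group_first_column_bound[OF assms(1) C(1)])
    ultimately obtain s where
      "norm (mat2 (C$1$1) (C$1$2) (C$2$1) (C$2$2) *v vec2 s (- v$2)) \<le> 2 * \<bar>- v$2\<bar>"
      by (rule exists_short_vector_on_line)
    then have s: "norm (C *v vec2 s (- v$2)) \<le> 2 * \<bar>v$2\<bar>" by (simp flip: mat2_eta)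
    define w where "w = C *v vec2 (v$1 + s) 0"
    have "w islimpt orbit q u"
      unfolding w_def by (intro orbit_limpt_mulv C(1) orbit_limpt_horizontal_axis assms)
    moreover have "vec2 (v$1 + s) 0 - v = vec2 s (- v$2)" by (simp add: vec_eq_iff forall_2)
    then have "w - u = C *v vec2 s (- v$2)"
      unfolding w_def C(2) matrix_vector_mult_diff_distrib[symmetric] by simp
    then have "dist w u < e" using s v(2) by (simp add: dist_norm)
    ultimately show "\<exists>w \<in> {w. w islimpt orbit q u}. dist w u < e" by blast
  qed
  then have "u islimpt orbit q u" using limpt_of_limpts by blast
  ultimately show False by contradiction
qed

theorem mainTheorem1:
  fixes q :: nat
  assumes "q \<ge> 3"
  shows
    "(\<forall>u :: real^2. discrete (orbit q u) \<longrightarrow>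
        u = 0 \<or> (\<exists>\<alpha>::real. \<alpha> \<noteq> 0 \<and> orbit q u = (\<lambda>v. \<alpha> *\<^sub>R v) ` hecke_Lambda q))
   \<and> (\<forall>v \<in> hecke_Lambda q. \<not> hecke_Q q v < 1)
   \<and> (\<forall>i. i \<le> q - 2 \<longrightarrow> wedge (hecke_w q i) (hecke_w q (i + 1)) = 1)
   \<and> wedge (hecke_w q 0) (hecke_w q (q - 1)) = 1
   \<and> (\<forall>u0 \<in> hecke_Lambda q. \<forall>u1 \<in> hecke_Lambda q. wedge u0 u1 = 1 \<longrightarrow>
        (\<exists>A \<in> hecke_group q. A *v u0 = vec2 1 0 \<and> A *v u1 = vec2 0 1)
        \<and> mat2 (u0$1) (u1$1) (u0$2) (u1$2) \<in> hecke_group q)"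
proof (intro conjI allI impI ballI)
  fix u :: "real^2"
  assume "discrete (orbit q u)"
  then show "u = 0 \<or> (\<exists>\<alpha>::real. \<alpha> \<noteq> 0 \<and> orbit q u = (\<lambda>v. \<alpha> *\<^sub>R v) ` hecke_Lambda q)"
    using orbit_not_discrete[OF assms] orbit_eq_scaled_Lambda by blast
next
  fix v assume "v \<in> hecke_Lambda q"
  then show "\<not> hecke_Q q v < 1" using hecke_Q_Lambda_ge_1[OF assms] by (simp add: not_less)
next
  show "wedge (hecke_w q i) (hecke_w q (i + 1)) = 1" for i
    using wedge_hecke_w_Suc by simp
next
  show "wedge (hecke_w q 0) (hecke_w q (q - 1)) = 1"
    using hecke_w_pred_q[OF assms] by (simp add: hecke_w_def wedge_def)
next
  fix u0 u1 assume "u0 \<in> hecke_Lambda q" "u1 \<in> hecke_Lambda q" "wedge u0 u1 = 1"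
  then show "\<exists>A \<in> hecke_group q. A *v u0 = vec2 1 0 \<and> A *v u1 = vec2 0 1"
    and "mat2 (u0$1) (u1$1) (u0$2) (u1$2) \<in> hecke_group q"
    using hecke_Lambda_unimodular_pair_normalize hecke_Lambda_unimodular_pair_in_group assms by blast+
qed

end
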